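(* Let $p/q$ be an even rational parameter. Then every unit square of the integer grid has either exactly $0$ or exactly $2$ good edges.
   Context: An even rational parameter is a rational number $p/q\in(0,1)$, with $p,q$ positive integers in lowest terms, such that $pq$ is even. Put $\omega=p+q$ (an odd integer), $P=2p/\omega$, $Q=2q/\omega$ (so $P+Q=2$). Consider four families of lines in $\mathbb R^2$: $\mathcal H$, the horizontal lines $y=n$ ($n\in\mathbb Z$); $\mathcal V$, the vertical lines $x=n$ ($n\in\mathbb Z$); $\mathcal P$, the lines of slope $-P$ with integer $y$-intercept; $\mathcal Q$, the lines of slope $-Q$ with integer $y$-intercept. Define functions $\mathbb R^2\to\mathbb R/2\mathbb Z$ by $F_H(x,y)=2Py$, $F_V(x,y)=2Px$, $F_P(x,y)=Py+P^2x+1$, $F_Q(x,y)=Py+PQx+1$, each value being identified with its representative in $(-1,1]$. A unit segment is an edge $[n,n+1]\times\{m\}$ or $\{n\}\times[m,m+1]$ ($n,m\in\mathbb Z$) of a unit square of the integer grid; a horizontal unit segment lies on a line of $\mathcal H$ (set $A=H$), a vertical one on a line of $\mathcal V$ (set $A=V$). A point $z$ of a unit segment $s$ is a light point of $s$ if there is $B\in\{P,Q\}$ such that $z$ lies on a line of the family $\mathcal B$ and $F_A(z)F_B(z)>0$ and $|F_B(z)|<|F_A(z)|$. The light count of $s$ is the number of distinct light points of $s$, except that when $s$ is horizontal and a light point is the midpoint of $s$, that point is counted twice. A unit segment is good if its light count is exactly $1$. *)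

theory Defs
  imports Complex_Main
begin

definition even_rational_param :: "nat \<Rightarrow> nat \<Rightarrow> bool" where
  "even_rational_param p q \<longleftrightarrow> 0 < p \<and> 0 < q \<and> p < q \<and> coprime p q \<and> even (p * q)"

definition PP :: "nat \<Rightarrow> nat \<Rightarrow> real" where
  "PP p q = 2 * real p / real (p + q)"

definition QQ :: "nat \<Rightarrow> nat \<Rightarrow> real" where
  "QQ p q = 2 * real q / real (p + q)"

text \<open>Representative in (-1,1] of a class in R/2Z.\<close>
definition rep2 :: "real \<Rightarrow> real" where
  "rep2 t = t - 2 * of_int \<lceil>(t - 1) / 2\<rceil>"

datatype fam = FamH | FamV | FamP | FamQ

fun Ffun :: "nat \<Rightarrow> nat \<Rightarrow> fam \<Rightarrow> real \<times> real \<Rightarrow> real" where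
  "Ffun p q FamH (x, y) = rep2 (2 * PP p q * y)"
| "Ffun p q FamV (x, y) = rep2 (2 * PP p q * x)"
| "Ffun p q FamP (x, y) = rep2 (PP p q * y + (PP p q)^2 * x + 1)"
| "Ffun p q FamQ (x, y) = rep2 (PP p q * y + PP p q * QQ p q * x + 1)"

fun on_family :: "nat \<Rightarrow> nat \<Rightarrow> fam \<Rightarrow> real \<times> real \<Rightarrow> bool" where
  "on_family p q FamH (x, y) = (y \<in> \<int>)"
| "on_family p q FamV (x, y) = (x \<in> \<int>)"
| "on_family p q FamP (x, y) = (\<exists>b::int. y = - PP p q * x + of_int b)"
| "on_family p q FamQ (x, y) = (\<exists>b::int. y = - QQ p q * x + of_int b)"

datatype useg = HSeg int int | VSeg int int

fun seg_points :: "useg \<Rightarrow> (real \<times> real) set" where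
  "seg_points (HSeg n m) = {of_int n .. of_int n + 1} \<times> {of_int m}"
| "seg_points (VSeg n m) = {of_int n} \<times> {of_int m .. of_int m + 1}"

fun seg_fam :: "useg \<Rightarrow> fam" where
  "seg_fam (HSeg n m) = FamH"
| "seg_fam (VSeg n m) = FamV"

fun seg_mid :: "useg \<Rightarrow> real \<times> real" where
  "seg_mid (HSeg n m) = (of_int n + 1/2, of_int m)"
| "seg_mid (VSeg n m) = (of_int n, of_int m + 1/2)"

fun is_horizontal :: "useg \<Rightarrow> bool" where
  "is_horizontal (HSeg n m) = True"
| "is_horizontal (VSeg n m) = False"

definition light_points :: "nat \<Rightarrow> nat \<Rightarrow> useg \<Rightarrow> (real \<times> real) set" where
  "light_points p q s = {z \<in> seg_points s. \<exists>B \<in> {FamP, FamQ}.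
      on_family p q B z \<and>
      Ffun p q (seg_fam s) z * Ffun p q B z > 0 \<and>
      \<bar>Ffun p q B z\<bar> < \<bar>Ffun p q (seg_fam s) z\<bar>}"

definition light_count :: "nat \<Rightarrow> nat \<Rightarrow> useg \<Rightarrow> nat" where
  "light_count p q s = card (light_points p q s)
     + (if is_horizontal s \<and> seg_mid s \<in> light_points p q s then 1 else 0)"

definition good :: "nat \<Rightarrow> nat \<Rightarrow> useg \<Rightarrow> bool" where
  "good p q s \<longleftrightarrow> light_count p q s = 1"

definition square_edges :: "int \<Rightarrow> int \<Rightarrow> useg set" where
  "square_edges n m = {HSeg n m, HSeg n (m + 1), VSeg n m, VSeg (n + 1) m}"

end

theory Submission
  imports Defs
begin

text \<open>
  The value of \<open>F\<^sub>P\<close> or \<open>F\<^sub>Q\<close> on a slanting line depends only on its integer intercept \<open>b\<close>: it is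
  the \<^emph>\<open>mass\<close> \<open>P b + 1\<close>. Hence a light point on an edge only compares a mass with the \<^emph>\<open>capacity\<close>
  \<open>2 P j\<close> of the grid line of index \<open>j\<close> that contains the edge. Writing \<open>f = \<lceil>P n\<rceil> - P n\<close>, exactly two
  slanting lines matter for every edge of the square (lines that meet on an edge
  are lit together there, which the midpoint rule accounts for), and for the four edges these masses are given by one
  formula when \<open>f < P\<close> and by another one when \<open>P \<le> f\<close>. Since \<open>P b\<close> is never an odd
  integer, masses never meet capacities modulo 2, and the theorem becomes a statement of linear
  arithmetic about the representatives in \<open>(-1, 1]\<close> of the capacities and masses.
\<close>

section \<open>Representatives modulo 2 and the linear arithmetic of light values\<close>

lemma rep2_bounds: "-1 < rep2 t" "rep2 t \<le> 1"
proof -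
  define c where "c = \<lceil>(t - 1) / 2\<rceil>"
  have "of_int c - 1 < (t - 1) / 2 \<and> (t - 1) / 2 \<le> of_int c"
    unfolding c_def by (rule ceiling_correct)
  then show "-1 < rep2 t" "rep2 t \<le> 1"
    by (auto simp: rep2_def c_def[symmetric] field_simps)
qed

lemma rep2_diff_even: obtains k :: int where "rep2 t = t + 2 * of_int k"
proof
  show "rep2 t = t + 2 * of_int (- \<lceil>(t - 1) / 2\<rceil>)"
    by (simp add: rep2_def)
qed

lemma rep2_unique:
  assumes "-1 < t + 2 * of_int k" "t + 2 * of_int k \<le> 1"
  shows "rep2 t = t + 2 * of_int k"
proof -
  have "\<lceil>(t - 1) / 2\<rceil> = - k"
    using assms by (intro ceiling_unique) (auto simp: field_simps)
  then show ?thesis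
    by (simp add: rep2_def)
qed

text \<open>The light condition for capacity \<open>k\<close> and mass \<open>x\<close>, written
  without product and absolute value so that only linear inequalities occur.\<close>

definition between :: "real \<Rightarrow> real \<Rightarrow> bool" where
  "between k x \<longleftrightarrow> 0 < x \<and> x < k \<or> k < x \<and> x < 0"

lemma between_iff: "between k x \<longleftrightarrow> 0 < k * x \<and> \<bar>x\<bar> < \<bar>k\<bar>"
  unfolding between_def by (auto simp: zero_less_mult_iff)

text \<open>The case \<open>f < P\<close>. \<open>X\<close>, \<open>X'\<close>, \<open>Y\<close>,
  \<open>Y'\<close> are the capacities of the left, right, bottom and top edges; primed masses have
  intercepts one higher. The disjunctions list the possible reductions modulo 2; each choice leaves
  linear inequalities. The first conclusion makes the number of good edges even, the second excludes
  4.\<close>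

lemma between_small_overlap:
  fixes P f X X' Y Y' A A' D D' :: real
  assumes "0 < P" "P < 1" "0 \<le> f" "f < P"
    "-1 < X" "X < 1" "-1 < X'" "X' < 1" "-1 < Y" "Y < 1" "-1 < Y'" "Y' < 1"
    "-1 < A" "A \<le> 1" "-1 < D" "D \<le> 1" "-1 < A'" "A' \<le> 1" "-1 < D'" "D' \<le> 1"
    "X = -2*f \<or> X = -2*f+2"
    "X' = 2*P-2*f \<or> X' = 2*P-2*f-2"
    "Y' = Y+2*P \<or> Y' = Y+2*P-2"
    "A' = A+P \<or> A' = A+P-2"
    "D' = D+P \<or> D' = D+P-2"
    "A+D = X+Y+P \<or> A+D = X+Y+P-2 \<or> A+D = X+Y+P-4 \<or> A+D = X+Y+P+2"
    "A \<noteq> 0" "D \<noteq> 0" "A' \<noteq> 0" "D' \<noteq> 0"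
    "A \<noteq> X" "D \<noteq> X" "A \<noteq> Y" "D \<noteq> Y" "A' \<noteq> X'" "D' \<noteq> X'" "A' \<noteq> Y'" "D' \<noteq> Y'"
  shows "((between X A \<noteq> between X D) \<noteq> (between X' A' \<noteq> between X' D')) =
         ((between Y A \<noteq> between Y D) \<noteq> (between Y' A' \<noteq> between Y' D'))"
    and "\<not> ((between X A \<noteq> between X D) \<and> (between X' A' \<noteq> between X' D') \<and>
            (between Y A \<noteq> between Y D) \<and> (between Y' A' \<noteq> between Y' D'))"
  using assms unfolding between_def by (smt (verit))+

text \<open>The case \<open>P \<le> f\<close>. Left and right edges share the mass \<open>A\<close>;
  \<open>D\<close>, \<open>D'\<close>, \<open>D''\<close> belong to consecutive intercepts, the
  first two used by the bottom edge and the last two by the top edge.\<close>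

lemma between_large_overlap:
  fixes P f X X' Y Y' A D D' D'' :: real
  assumes "0 < P" "P < 1" "P \<le> f" "f < 1"
    "-1 < X" "X < 1" "-1 < X'" "X' < 1" "-1 < Y" "Y < 1" "-1 < Y'" "Y' < 1"
    "-1 < A" "A \<le> 1" "-1 < D" "D \<le> 1" "-1 < D'" "D' \<le> 1" "-1 < D''" "D'' \<le> 1"
    "X = -2*f \<or> X = -2*f+2"
    "X' = 2*P-2*f \<or> X' = 2*P-2*f+2"
    "Y' = Y+2*P \<or> Y' = Y+2*P-2"
    "D' = D+P \<or> D' = D+P-2"
    "D'' = D'+P \<or> D'' = D'+P-2"
    "A+D = X+Y+P \<or> A+D = X+Y+P-2 \<or> A+D = X+Y+P-4 \<or> A+D = X+Y+P+2"
    "A \<noteq> 0" "D \<noteq> 0" "D' \<noteq> 0" "D'' \<noteq> 0"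
    "A \<noteq> X" "D \<noteq> X" "A \<noteq> X'" "D'' \<noteq> X'" "D \<noteq> Y" "D' \<noteq> Y" "D' \<noteq> Y'" "D'' \<noteq> Y'"
  shows "((between X A \<noteq> between X D) \<noteq> (between X' A \<noteq> between X' D'')) =
         ((between Y D \<noteq> between Y D') \<noteq> (between Y' D' \<noteq> between Y' D''))"
    and "\<not> ((between X A \<noteq> between X D) \<and> (between X' A \<noteq> between X' D'') \<and>
            (between Y D \<noteq> between Y D') \<and> (between Y' D' \<noteq> between Y' D''))"
  using assms unfolding between_def by (smt (verit))+

lemma unit_interval_scale:
  fixes B w y :: real
  assumes "0 < B"
  shows "0 \<le> y \<and> y \<le> 1 \<and> B * y = w \<longleftrightarrow> 0 \<le> w \<and> w \<le> B \<and> y = w / B"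
  using assms by (auto simp: field_simps zero_le_mult_iff)

section \<open>Capacities and masses of a fixed parameter\<close>

locale even_rational =
  fixes p q :: nat
  assumes param: "even_rational_param p q"
begin

abbreviation "P \<equiv> PP p q"
abbreviation "Q \<equiv> QQ p q"

definition cap :: "int \<Rightarrow> real" where
  "cap j = rep2 (2 * P * of_int j)"

definition mass :: "int \<Rightarrow> real" where
  "mass b = rep2 (P * of_int b + 1)"

abbreviation lit :: "int \<Rightarrow> int \<Rightarrow> bool" where
  "lit j b \<equiv> between (cap j) (mass b)"

lemma P_pos: "0 < P" and P_less_1: "P < 1" and Q_eq: "Q = 2 - P"
  using param by (auto simp: even_rational_param_def PP_def QQ_def field_simps)

text \<open>Clearing the denominator would equate the even number \<open>2 * p * b\<close> with a
  product of two odd numbers.\<close>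

lemma P_mult_not_odd: "P * of_int b \<noteq> 2 * of_int k + 1"
proof
  \<comment> \<open>As \<open>p * q\<close> is even and \<open>p\<close>, \<open>q\<close> are
    coprime, exactly one of them is even.\<close>
  have odd: "odd (p + q)"
    using param by (auto simp: even_rational_param_def dest: coprime_common_divisor_nat[of _ _ 2])
  assume "P * of_int b = 2 * of_int k + 1"
  moreover have "real (p + q) > 0"
    using param by (auto simp: even_rational_param_def)
  ultimately have "2 * real p * of_int b = (2 * of_int k + 1) * real (p + q)"
    by (simp add: PP_def field_simps)
  then have "real_of_int (2 * int p * b) = real_of_int ((2 * k + 1) * int (p + q))"
    by simp
  then have "2 * int p * b = (2 * k + 1) * int (p + q)"
    by (simp only: of_int_eq_iff)
  then have "even ((2 * k + 1) * int (p + q))"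
    by (metis dvd_triv_left mult.assoc)
  with odd show False by simp
qed

lemma cap_bounds: "-1 < cap j" "cap j < 1"
proof -
  obtain k where k: "rep2 (2 * P * of_int j) = 2 * P * of_int j + 2 * of_int k"
    by (rule rep2_diff_even)
  have "P * of_int (2 * j) \<noteq> 2 * of_int (- k) + 1"
    by (rule P_mult_not_odd)
  with k have "cap j \<noteq> 1" by (auto simp: cap_def)
  then show "-1 < cap j" "cap j < 1"
    using rep2_bounds[of "2 * P * of_int j"] by (auto simp: cap_def)
qed

lemma mass_bounds: "-1 < mass b" "mass b \<le> 1"
  using rep2_bounds by (auto simp: mass_def)

lemma mass_nonzero: "mass b \<noteq> 0"
proof -
  obtain k where k: "rep2 (P * of_int b + 1) = P * of_int b + 1 + 2 * of_int k"
    by (rule rep2_diff_even)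
  have "P * of_int b \<noteq> 2 * of_int (- k - 1) + 1"
    by (rule P_mult_not_odd)
  with k show ?thesis by (auto simp: mass_def)
qed

lemma mass_neq_cap: "mass b \<noteq> cap j"
proof -
  obtain k where k: "rep2 (P * of_int b + 1) = P * of_int b + 1 + 2 * of_int k"
    by (rule rep2_diff_even)
  obtain l where l: "rep2 (2 * P * of_int j) = 2 * P * of_int j + 2 * of_int l"
    by (rule rep2_diff_even)
  have "P * of_int (b - 2 * j) \<noteq> 2 * of_int (l - k - 1) + 1"
    by (rule P_mult_not_odd)
  with k l show ?thesis by (auto simp: mass_def cap_def algebra_simps)
qed

lemma mass_add_1: "mass (b + 1) = mass b + P \<or> mass (b + 1) = mass b + P - 2"
proof -
  obtain i where i: "mass b = P * of_int b + 1 + 2 * of_int i"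
    unfolding mass_def by (rule rep2_diff_even)
  obtain j where j: "mass (b + 1) = P * of_int (b + 1) + 1 + 2 * of_int j"
    unfolding mass_def by (rule rep2_diff_even)
  define r where "r = j - i"
  have eq: "mass (b + 1) = mass b + P + 2 * of_int r"
    using i j by (simp add: r_def algebra_simps)
  \<comment> \<open>Both masses lie in an interval of length 2 and \<open>0 < P < 1\<close>, so
    \<open>-3 < 2 * r < 2\<close>.\<close>
  then have "r = 0 \<or> r = -1"
    using mass_bounds[of b] mass_bounds[of "b + 1"] P_pos P_less_1 by linarith
  with eq show ?thesis by auto
qed

lemma cap_add_1: "cap (j + 1) = cap j + 2 * P \<or> cap (j + 1) = cap j + 2 * P - 2"
proof -
  obtain i where i: "cap j = 2 * P * of_int j + 2 * of_int i"
    unfolding cap_def by (rule rep2_diff_even)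
  obtain k where k: "cap (j + 1) = 2 * P * of_int (j + 1) + 2 * of_int k"
    unfolding cap_def by (rule rep2_diff_even)
  define r where "r = k - i"
  have eq: "cap (j + 1) = cap j + 2 * P + 2 * of_int r"
    using i k by (simp add: r_def algebra_simps)
  then have "r = 0 \<or> r = -1"
    using cap_bounds[of j] cap_bounds[of "j + 1"] P_pos P_less_1 by linarith
  with eq show ?thesis by auto
qed

text \<open>\<open>2 * P * of_int j\<close> and \<open>-2 * f\<close> differ by twice the ceiling,
  an even integer.\<close>

lemma cap_of_ceiling:
  assumes "f = of_int \<lceil>P * of_int j\<rceil> - P * of_int j"
  shows "cap j = -2 * f \<or> cap j = -2 * f + 2"
proof -
  obtain i where i: "cap j = 2 * P * of_int j + 2 * of_int i"
    unfolding cap_def by (rule rep2_diff_even)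
  define r where "r = i + \<lceil>P * of_int j\<rceil>"
  have eq: "cap j = -2 * f + 2 * of_int r"
    using i assms by (simp add: r_def algebra_simps)
  have "0 \<le> f" "f < 1"
    using assms by linarith+
  with eq have "r = 0 \<or> r = 1"
    using cap_bounds[of j] by linarith
  with eq show ?thesis by auto
qed

lemma cap_eq_0:
  assumes "P * of_int j = of_int c"
  shows "cap j = 0"
  using rep2_unique[of "2 * P * of_int j" "- c"] assms by (simp add: cap_def)

lemma mass_sum:
  obtains k :: int where
    "mass b + mass b' = P * of_int (b + b') + 2 * of_int k"
proof -
  obtain i where i: "mass b = P * of_int b + 1 + 2 * of_int i"
    unfolding mass_def by (rule rep2_diff_even)
  obtain j where j: "mass b' = P * of_int b' + 1 + 2 * of_int j"
    unfolding mass_def by (rule rep2_diff_even)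
  have "mass b + mass b' = P * of_int (b + b') + 2 * of_int (i + j + 1)"
    using i j by (simp add: algebra_simps)
  then show thesis by (rule that)
qed

text \<open>If the two masses add up to the capacity modulo 2, then the short arc from 0 to the capacity is
  mapped to itself by exchanging them. This happens whenever two slanting lines meet on a horizontal edge.\<close>
lemma lit_cong:
  assumes "P * of_int (b + b') = 2 * P * of_int j + 2 * of_int k"
  shows "lit j b \<longleftrightarrow> lit j b'"
proof -
  obtain i where i: "cap j = 2 * P * of_int j + 2 * of_int i"
    unfolding cap_def by (rule rep2_diff_even)
  obtain l where l: "mass b + mass b' = P * of_int (b + b') + 2 * of_int l"
    by (rule mass_sum)
  define r where "r = k + l - i"
  have eq: "mass b + mass b' = cap j + 2 * of_int r"
    using assms i l by (simp add: r_def)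
  \<comment> \<open>For \<open>r = 0\<close> the masses are mirror images in half the capacity.
    Otherwise the bounds push both masses beyond 0 and the capacity on the same side, so neither is
    lit.\<close>
  have "r \<le> -1 \<or> r = 0 \<or> 1 \<le> r" by linarith
  then have "real_of_int r \<le> -1 \<or> r = 0 \<or> 1 \<le> real_of_int r" by linarith
  with eq show ?thesis
    using mass_bounds[of b] mass_bounds[of b'] cap_bounds[of j]
    unfolding between_def by (smt (verit) of_int_0)
qed

section \<open>Light points and good edges in terms of masses\<close>

lemma Ffun_on_line:
  assumes "y = - B * x + of_int b"
  shows "rep2 (P * y + P * B * x + 1) = mass b"
  unfolding assms mass_def by (simp add: algebra_simps)

lemma Ffun_slanted: "Ffun p q FamP (x, y) = rep2 (P * y + P * P * x + 1)"
    "Ffun p q FamQ (x, y) = rep2 (P * y + P * Q * x + 1)"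
  by (simp_all add: power2_eq_square)

lemma in_light_points_iff:
  "(x, y) \<in> light_points p q s \<longleftrightarrow> (x, y) \<in> seg_points s \<and>
     (\<exists>b. (y = - P * x + of_int b \<or> y = - Q * x + of_int b) \<and>
          between (Ffun p q (seg_fam s) (x, y)) (mass b))"
  unfolding light_points_def between_iff
  by (auto simp del: Ffun.simps simp: Ffun_slanted Ffun_on_line)

lemma in_light_points_VSeg_iff:
  "(x, y) \<in> light_points p q (VSeg n m) \<longleftrightarrow> x = of_int n \<and> of_int m \<le> y \<and> y \<le> of_int m + 1 \<and>
     (\<exists>b. (y = of_int b - P * of_int n \<or> y = of_int b - Q * of_int n) \<and> lit n b)"
  by (auto simp: in_light_points_iff cap_def)

text \<open>Here \<open>x\<close> is the offset from the left endpoint, which prepares for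
  \<open>unit_interval_scale\<close>.\<close>

lemma in_light_points_HSeg_iff:
  "(of_int n + x, y) \<in> light_points p q (HSeg n m) \<longleftrightarrow> y = of_int m \<and> 0 \<le> x \<and> x \<le> 1 \<and>
     (\<exists>b. (P * (of_int n + x) = of_int (b - m) \<or> Q * (of_int n + x) = of_int (b - m)) \<and> lit m b)"
proof -
  have "B * z = of_int (b - m) \<longleftrightarrow> of_int m = - B * z + of_int b" for B z :: real and b
    by auto
  then show ?thesis
    by (auto simp: in_light_points_iff cap_def)
qed

text \<open>Unless everything is dark, one P-line and one Q-line cross the edge, at different
  points. The light count is then the number of lit lines among the two, and it is 1 iff they
  differ.\<close>

lemma good_VSeg:
  assumes c: "c = \<lceil>P * of_int n\<rceil>"
  shows "good p q (VSeg n m) \<longleftrightarrow> lit n (m + c) \<noteq> lit n (m + 2 * n + 1 - c)"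
proof (cases "P * of_int n = of_int c")
  \<comment> \<open>Slanting lines may now pass through the corners, but the capacity is 0 and
    nothing is lit.\<close>
  case True
  then have dark: "\<not> lit n b" for b
    using cap_eq_0[of n c] by (simp add: between_def)
  then have "light_points p q (VSeg n m) = {}"
    by (auto simp: in_light_points_VSeg_iff)
  with dark show ?thesis
    by (simp add: good_def light_count_def)
next
  case False
  define f where "f = of_int c - P * of_int n"
  have f: "0 < f" "f < 1"
    using False unfolding f_def c by linarith+
  \<comment> \<open>Crossing points at equal height would mean \<open>f = 1 / 2\<close>, making
    \<open>P * of_int (2 * n)\<close> the odd integer \<open>2 * c - 1\<close>.\<close>
  have "P * of_int (2 * n) \<noteq> 2 * of_int (c - 1) + 1"
    by (rule P_mult_not_odd)
  then have "f \<noteq> 1 - f"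
    by (auto simp: f_def)
  have PQ: "of_int b - P * of_int n = of_int (b - c) + f"
    "of_int b - Q * of_int n = of_int (b - 2 * n + c) - f" for b
    by (auto simp: f_def Q_eq algebra_simps)
  have *: "of_int m \<le> y \<and> y \<le> of_int m + 1 \<and> y = of_int b - P * of_int n \<longleftrightarrow>
      b = m + c \<and> y = of_int m + f" for y b
  proof -
    have "of_int m \<le> of_int (b - c) + f \<and> of_int (b - c) + f \<le> of_int m + 1 \<longleftrightarrow> b = m + c"
      using f by linarith
    then show ?thesis unfolding PQ by auto
  qed
  have **: "of_int m \<le> y \<and> y \<le> of_int m + 1 \<and> y = of_int b - Q * of_int n \<longleftrightarrow>
      b = m + 2 * n + 1 - c \<and> y = of_int m + (1 - f)" for y b
  proof -
    have "of_int m \<le> of_int (b - 2 * n + c) - f \<and> of_int (b - 2 * n + c) - f \<le> of_int m + 1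
        \<longleftrightarrow> b = m + 2 * n + 1 - c"
      using f by linarith
    then show ?thesis unfolding PQ by auto
  qed
  have "light_points p q (VSeg n m) =
      (if lit n (m + c) then {(of_int n, of_int m + f)} else {}) \<union>
      (if lit n (m + 2 * n + 1 - c) then {(of_int n, of_int m + (1 - f))} else {})" (is "_ = ?R")
  proof (rule set_eqI, clarify)
    fix x y
    have "(x, y) \<in> light_points p q (VSeg n m) \<longleftrightarrow> x = of_int n \<and>
        (\<exists>b. (of_int m \<le> y \<and> y \<le> of_int m + 1 \<and> y = of_int b - P * of_int n \<or>
              of_int m \<le> y \<and> y \<le> of_int m + 1 \<and> y = of_int b - Q * of_int n) \<and> lit n b)"
      unfolding in_light_points_VSeg_iff by blast
    also have "\<dots> \<longleftrightarrow> (x, y) \<in> ?R"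
      unfolding * ** by auto
    finally show "(x, y) \<in> light_points p q (VSeg n m) \<longleftrightarrow> (x, y) \<in> ?R" .
  qed
  then show ?thesis
    using \<open>f \<noteq> 1 - f\<close> by (auto simp: good_def light_count_def card_insert_if)
qed

text \<open>This is where counting a light midpoint twice matters: it keeps the light count even when the
  two slanting lines meet there.\<close>
lemma good_HSeg_if_light_points:
  assumes pts: "light_points p q (HSeg n m) =
      (if lit m b then {(of_int n + s, of_int m)} else {}) \<union>
      (if lit m b' then {(of_int n + t, of_int m)} else {})"
    and meet: "s = t \<Longrightarrow> lit m b \<longleftrightarrow> lit m b'"
    and mid: "s = 1 / 2 \<or> t = 1 / 2 \<longleftrightarrow> s = t"
  shows "good p q (HSeg n m) \<longleftrightarrow> lit m b \<noteq> lit m b'"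
proof (cases "s = t")
  case True
  then have "s = 1 / 2" "t = 1 / 2" using mid by auto
  then show ?thesis
    using meet[OF True] by (auto simp: good_def light_count_def pts)
next
  case False
  then have "s \<noteq> 1 / 2" "t \<noteq> 1 / 2" using mid by auto
  then show ?thesis
    using False by (auto simp: good_def light_count_def pts card_insert_if)
qed

text \<open>One P-line and one Q-line cross the edge, at offsets \<open>f / P\<close> and
  \<open>(1 - f) / Q\<close>. A further Q-line appears only for \<open>f = 0\<close>, through the
  left endpoint.\<close>

lemma good_HSeg_small:
  assumes c: "c = \<lceil>P * of_int n\<rceil>" and small: "of_int c - P * of_int n < P"
  shows "good p q (HSeg n m) \<longleftrightarrow> lit m (m + c) \<noteq> lit m (m + 2 * n + 1 - c)"
proof -
  define f where "f = of_int c - P * of_int n"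
  have f: "0 \<le> f" "f < P"
    using small unfolding f_def c by linarith+
  have Q: "0 < Q" using P_less_1 Q_eq by simp
  have onP: "0 \<le> y \<and> y \<le> 1 \<and> P * (of_int n + y) = of_int (b - m) \<longleftrightarrow>
      b = m + c \<and> y = f / P"
    (is "_ \<longleftrightarrow> ?rhs") for y b
  proof -
    define r where "r = b - m - c"
    have "0 \<le> y \<and> y \<le> 1 \<and> P * (of_int n + y) = of_int (b - m) \<longleftrightarrow>
        0 \<le> y \<and> y \<le> 1 \<and> P * y = of_int r + f"
      by (auto simp: f_def r_def Q_eq algebra_simps)
    also have "\<dots> \<longleftrightarrow> 0 \<le> of_int r + f \<and> of_int r + f \<le> P \<and> y = (of_int r + f) / P"
      using P_pos Q by (intro unit_interval_scale)
    also have "\<dots> \<longleftrightarrow> r = 0 \<and> y = (of_int r + f) / P"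
    proof -
      have "0 \<le> of_int r + f \<and> of_int r + f \<le> P \<longleftrightarrow> r = 0"
        using f P_less_1 by linarith
      then show ?thesis by blast
    qed
    also have "\<dots> \<longleftrightarrow> r = 0 \<and> y = f / P"
      using P_pos by auto
    also have "\<dots> \<longleftrightarrow> ?rhs"
      by (auto simp: r_def)
    finally show ?thesis .
  qed
  have onQ: "0 \<le> y \<and> y \<le> 1 \<and> Q * (of_int n + y) = of_int (b - m) \<longleftrightarrow>
      b = m + 2 * n + 1 - c \<and> y = (1 - f) / Q \<or> f = 0 \<and> b = m + 2 * n - c \<and> y = 0"
    (is "_ \<longleftrightarrow> ?rhs") for y b
  proof -
    define r where "r = b - m - 2 * n + c"
    have "0 \<le> y \<and> y \<le> 1 \<and> Q * (of_int n + y) = of_int (b - m) \<longleftrightarrow>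
        0 \<le> y \<and> y \<le> 1 \<and> Q * y = of_int r - f"
      by (auto simp: f_def r_def Q_eq algebra_simps)
    also have "\<dots> \<longleftrightarrow> 0 \<le> of_int r - f \<and> of_int r - f \<le> Q \<and> y = (of_int r - f) / Q"
      using P_pos Q by (intro unit_interval_scale)
    also have "\<dots> \<longleftrightarrow> (r = 1 \<or> f = 0 \<and> r = 0) \<and> y = (of_int r - f) / Q"
    proof -
      have "0 \<le> of_int r - f \<and> of_int r - f \<le> Q \<longleftrightarrow> r = 1 \<or> f = 0 \<and> r = 0"
        using f P_less_1 Q_eq by linarith
      then show ?thesis by blast
    qed
    also have "\<dots> \<longleftrightarrow> r = 1 \<and> y = (1 - f) / Q \<or> f = 0 \<and> r = 0 \<and> y = 0"
      using P_pos by auto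
    also have "\<dots> \<longleftrightarrow> ?rhs"
      by (auto simp: r_def)
    finally show ?thesis .
  qed
  \<comment> \<open>The extra Q-line meets the P-line at the corner; \<open>lit_cong\<close> lights
    both or neither, so it adds no light point.\<close>
  have corner: "lit m (m + c) \<longleftrightarrow> lit m (m + 2 * n - c)" if "f = 0"
    using that by (intro lit_cong[of _ _ _ c]) (simp add: f_def algebra_simps)
  show ?thesis
  proof (rule good_HSeg_if_light_points)
    show "light_points p q (HSeg n m) =
        (if lit m (m + c) then {(of_int n + f / P, of_int m)} else {}) \<union>
        (if lit m (m + 2 * n + 1 - c) then {(of_int n + (1 - f) / Q, of_int m)} else {})" (is "_ = ?R")
    proof (rule set_eqI, clarify)
      fix x' y :: real
      define x where "x = x' - of_int n"
      have "(of_int n + x, y) \<in> light_points p q (HSeg n m) \<longleftrightarrow> y = of_int m \<and>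
          (\<exists>b. (0 \<le> x \<and> x \<le> 1 \<and> P * (of_int n + x) = of_int (b - m) \<or>
                0 \<le> x \<and> x \<le> 1 \<and> Q * (of_int n + x) = of_int (b - m)) \<and> lit m b)"
        unfolding in_light_points_HSeg_iff by blast
      also have "\<dots> \<longleftrightarrow> (of_int n + x, y) \<in> ?R"
        unfolding onP onQ using corner by auto
      finally show "(x', y) \<in> light_points p q (HSeg n m) \<longleftrightarrow> (x', y) \<in> ?R"
        by (simp add: x_def)
    qed
    show "lit m (m + c) \<longleftrightarrow> lit m (m + 2 * n + 1 - c)" if "f / P = (1 - f) / Q"
    proof -
      have "2 * f = P"
        using that P_pos Q by (simp add: Q_eq field_simps)
      then show ?thesis
        by (intro lit_cong[of _ _ _ c]) (simp add: f_def algebra_simps)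
    qed
    \<comment> \<open>As \<open>P + Q = 2\<close>, all three equations say \<open>2 * f = P\<close>:
      the lines meet at the midpoint or not at all.\<close>
    show "f / P = 1 / 2 \<or> (1 - f) / Q = 1 / 2 \<longleftrightarrow> f / P = (1 - f) / Q"
      using P_pos P_less_1 by (auto simp: Q_eq field_simps)
  qed
qed

text \<open>Two consecutive Q-lines now cross the edge, since \<open>2 - f \<le> Q\<close>. A P-line
  touches it only for \<open>f = P\<close>, at the right endpoint.\<close>

lemma good_HSeg_large:
  assumes c: "c = \<lceil>P * of_int n\<rceil>" and large: "P \<le> of_int c - P * of_int n"
  shows "good p q (HSeg n m) \<longleftrightarrow> lit m (m + 2 * n + 1 - c) \<noteq> lit m (m + 2 * n + 2 - c)"
proof -
  define f where "f = of_int c - P * of_int n"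
  have f: "P \<le> f" "f < 1"
    using large unfolding f_def c by linarith+
  have Q: "0 < Q" using P_less_1 Q_eq by simp
  have onP: "0 \<le> y \<and> y \<le> 1 \<and> P * (of_int n + y) = of_int (b - m) \<longleftrightarrow>
      f = P \<and> b = m + c \<and> y = 1"
    (is "_ \<longleftrightarrow> ?rhs") for y b
  proof -
    define r where "r = b - m - c"
    have "0 \<le> y \<and> y \<le> 1 \<and> P * (of_int n + y) = of_int (b - m) \<longleftrightarrow>
        0 \<le> y \<and> y \<le> 1 \<and> P * y = of_int r + f"
      by (auto simp: f_def r_def Q_eq algebra_simps)
    also have "\<dots> \<longleftrightarrow> 0 \<le> of_int r + f \<and> of_int r + f \<le> P \<and> y = (of_int r + f) / P"
      using P_pos Q by (intro unit_interval_scale)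
    also have "\<dots> \<longleftrightarrow> (f = P \<and> r = 0) \<and> y = (of_int r + f) / P"
    proof -
      have "0 \<le> of_int r + f \<and> of_int r + f \<le> P \<longleftrightarrow> f = P \<and> r = 0"
        using f P_pos by (smt (verit) of_int_0 of_int_le_0_iff of_int_less_iff
            of_int_1 le_minus_iff of_int_minus)
      then show ?thesis by blast
    qed
    also have "\<dots> \<longleftrightarrow> f = P \<and> r = 0 \<and> y = 1"
      using P_pos by auto
    also have "\<dots> \<longleftrightarrow> ?rhs"
      by (auto simp: r_def)
    finally show ?thesis .
  qed
  have onQ: "0 \<le> y \<and> y \<le> 1 \<and> Q * (of_int n + y) = of_int (b - m) \<longleftrightarrow>
      b = m + 2 * n + 1 - c \<and> y = (1 - f) / Q \<or> b = m + 2 * n + 2 - c \<and> y = (2 - f) / Q"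
    (is "_ \<longleftrightarrow> ?rhs") for y b
  proof -
    define r where "r = b - m - 2 * n + c"
    have "0 \<le> y \<and> y \<le> 1 \<and> Q * (of_int n + y) = of_int (b - m) \<longleftrightarrow>
        0 \<le> y \<and> y \<le> 1 \<and> Q * y = of_int r - f"
      by (auto simp: f_def r_def Q_eq algebra_simps)
    also have "\<dots> \<longleftrightarrow> 0 \<le> of_int r - f \<and> of_int r - f \<le> Q \<and> y = (of_int r - f) / Q"
      using P_pos Q by (intro unit_interval_scale)
    also have "\<dots> \<longleftrightarrow> (r = 1 \<or> r = 2) \<and> y = (of_int r - f) / Q"
    proof -
      have "0 \<le> of_int r - f \<and> of_int r - f \<le> Q \<longleftrightarrow> r = 1 \<or> r = 2"
        using f P_pos Q_eq by linarith
      then show ?thesis by blast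
    qed
    also have "\<dots> \<longleftrightarrow> r = 1 \<and> y = (1 - f) / Q \<or> r = 2 \<and> y = (2 - f) / Q"
      using P_pos by auto
    also have "\<dots> \<longleftrightarrow> ?rhs"
      by (auto simp: r_def)
    finally show ?thesis .
  qed
  \<comment> \<open>At the right endpoint the P-line meets the upper of the two Q-lines, and both
    are lit or dark together.\<close>
  have corner: "lit m (m + c) \<longleftrightarrow> lit m (m + 2 * n + 2 - c)" "(2 - f) / Q = 1" if "f = P"
  proof -
    show "lit m (m + c) \<longleftrightarrow> lit m (m + 2 * n + 2 - c)"
      using that by (intro lit_cong[of _ _ _ c]) (simp add: f_def algebra_simps)
    show "(2 - f) / Q = 1"
      using that P_less_1 by (simp add: Q_eq)
  qed
  show ?thesis
  proof (rule good_HSeg_if_light_points)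
    show "light_points p q (HSeg n m) =
        (if lit m (m + 2 * n + 1 - c) then {(of_int n + (1 - f) / Q, of_int m)} else {}) \<union>
        (if lit m (m + 2 * n + 2 - c) then {(of_int n + (2 - f) / Q, of_int m)} else {})" (is "_ = ?R")
    proof (rule set_eqI, clarify)
      fix x' y :: real
      define x where "x = x' - of_int n"
      have "(of_int n + x, y) \<in> light_points p q (HSeg n m) \<longleftrightarrow> y = of_int m \<and>
          (\<exists>b. (0 \<le> x \<and> x \<le> 1 \<and> P * (of_int n + x) = of_int (b - m) \<or>
                0 \<le> x \<and> x \<le> 1 \<and> Q * (of_int n + x) = of_int (b - m)) \<and> lit m b)"
        unfolding in_light_points_HSeg_iff by blast
      also have "\<dots> \<longleftrightarrow> (of_int n + x, y) \<in> ?R"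
        unfolding onP onQ using corner by auto
      finally show "(x', y) \<in> light_points p q (HSeg n m) \<longleftrightarrow> (x', y) \<in> ?R"
        by (simp add: x_def)
    qed
    have neq: "(1 - f) / Q \<noteq> (2 - f) / Q"
      using Q by (simp add: field_simps)
    then show "lit m (m + 2 * n + 1 - c) \<longleftrightarrow> lit m (m + 2 * n + 2 - c)"
      if "(1 - f) / Q = (2 - f) / Q"
      using that by simp
    \<comment> \<open>Midpoint offsets would need \<open>2 * f = P\<close> or
      \<open>2 * f = 2 + P\<close>, against \<open>P \<le> f < 1\<close>.\<close>
    have "(1 - f) / Q \<noteq> 1 / 2" "(2 - f) / Q \<noteq> 1 / 2"
      using f P_pos P_less_1 by (auto simp: Q_eq field_simps)
    with neq show "(1 - f) / Q = 1 / 2 \<or> (2 - f) / Q = 1 / 2 \<longleftrightarrow> (1 - f) / Q = (2 - f) / Q"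
      by simp
  qed
qed

end

section \<open>Counting the good edges of a square\<close>

lemma card_Collect_insert4:
  assumes "distinct [a, b, c, d]"
  shows "card {x \<in> {a, b, c, d}. R x} = of_bool (R a) + of_bool (R b) + of_bool (R c) + of_bool (R d)"
proof -
  have "{x \<in> {a, b, c, d}. R x} = set (filter R [a, b, c, d])" by auto
  also have "card \<dots> = length (filter R [a, b, c, d])"
    using assms by (intro distinct_card distinct_filter)
  finally show ?thesis by simp
qed

theorem theorem2p1:
  fixes p q :: nat and n m :: int
  assumes "even_rational_param p q"
  shows "card {s \<in> square_edges n m. good p q s} = 0 \<or>
         card {s \<in> square_edges n m. good p q s} = 2"
proof -
  interpret even_rational p q by unfold_locales (rule assms)
  define c where "c = \<lceil>P * of_int n\<rceil>"
  define f where "f = of_int c - P * of_int n"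
  \<comment> \<open>\<open>b\<close> and \<open>d\<close> are the intercepts of the P-line and the
    Q-line that matter for the left edge; those for the other edges are shifts of them.\<close>
  define b where "b = m + c"
  define d where "d = m + 2 * n + 1 - c"
  define L R B T where "L = good p q (VSeg n m)" and "R = good p q (VSeg (n + 1) m)"
    and "B = good p q (HSeg n m)" and "T = good p q (HSeg n (m + 1))"
  have f: "0 \<le> f" "f < 1" unfolding f_def c_def by linarith+
  have L: "L \<longleftrightarrow> lit n b \<noteq> lit n d"
    unfolding L_def b_def d_def by (rule good_VSeg[OF c_def])
  \<comment> \<open>Since \<open>b + d = 2 * m + 2 * n + 1\<close>, the masses add up to both
    capacities plus \<open>P\<close> modulo 2. The bounds give \<open>-5 < 2 * r < 4\<close>, hence
    four cases.\<close>
  have sum: "mass b + mass d = cap n + cap m + P \<or> mass b + mass d = cap n + cap m + P - 2 \<or>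
    mass b + mass d = cap n + cap m + P - 4 \<or> mass b + mass d = cap n + cap m + P + 2"
  proof -
    obtain i where i: "cap n = 2 * P * of_int n + 2 * of_int i"
      unfolding cap_def by (rule rep2_diff_even)
    obtain j where j: "cap m = 2 * P * of_int m + 2 * of_int j"
      unfolding cap_def by (rule rep2_diff_even)
    obtain k where k: "mass b + mass d = P * of_int (b + d) + 2 * of_int k"
      by (rule mass_sum)
    define r where "r = k - i - j"
    have eq: "mass b + mass d = cap n + cap m + P + 2 * of_int r"
      using i j k by (simp add: r_def b_def d_def algebra_simps)
    then have "r = 0 \<or> r = -1 \<or> r = -2 \<or> r = 1"
      using mass_bounds[of b] mass_bounds[of d] cap_bounds[of n] cap_bounds[of m] P_pos P_less_1
      by linarith
    with eq show ?thesis by auto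
  qed
  \<comment> \<open>The number of good edges is even and not 4, so it is 0 or 2.\<close>
  have "((L \<noteq> R) = (B \<noteq> T)) \<and> \<not> (L \<and> R \<and> B \<and> T)"
  proof (cases "f < P")
    case True
    \<comment> \<open>\<open>P * of_int (n + 1)\<close> is \<open>c + (P - f)\<close> with
      \<open>0 < P - f < 1\<close>, so the ceiling rises by 1 and both intercepts of the right edge
      do too.\<close>
    have c': "c + 1 = \<lceil>P * of_int (n + 1)\<rceil>"
      using True f P_less_1 unfolding f_def by (simp add: algebra_simps) linarith
    have R: "R \<longleftrightarrow> lit (n + 1) (b + 1) \<noteq> lit (n + 1) (d + 1)"
      using good_VSeg[OF c', of m] by (simp add: R_def b_def d_def algebra_simps)
    have B: "B \<longleftrightarrow> lit m b \<noteq> lit m d"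
      using good_HSeg_small[OF c_def, of m] True by (simp add: B_def b_def d_def f_def)
    have T: "T \<longleftrightarrow> lit (m + 1) (b + 1) \<noteq> lit (m + 1) (d + 1)"
      using good_HSeg_small[OF c_def, of "m + 1"] True
      by (simp add: T_def b_def d_def f_def algebra_simps)
    have f': "f - P + 1 = of_int \<lceil>P * of_int (n + 1)\<rceil> - P * of_int (n + 1)"
      unfolding c'[symmetric] f_def by (simp add: algebra_simps)
    have cap': "cap (n + 1) = 2 * P - 2 * f \<or> cap (n + 1) = 2 * P - 2 * f - 2"
      using cap_of_ceiling[OF f'] by auto
    note between_small_overlap[OF P_pos P_less_1 f(1) True
        cap_bounds[of n] cap_bounds[of "n + 1"] cap_bounds[of m] cap_bounds[of "m + 1"]
        mass_bounds[of b] mass_bounds[of d] mass_bounds[of "b + 1"] mass_bounds[of "d + 1"]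
        cap_of_ceiling[OF f_def[unfolded c_def]] cap' cap_add_1 mass_add_1 mass_add_1 sum
        mass_nonzero mass_nonzero mass_nonzero mass_nonzero
        mass_neq_cap mass_neq_cap mass_neq_cap mass_neq_cap
        mass_neq_cap mass_neq_cap mass_neq_cap mass_neq_cap]
    then show ?thesis
      unfolding L R B T by blast
  next
    case False
    then have large: "P \<le> f" by simp
    \<comment> \<open>Now \<open>P * of_int (n + 1)\<close> is \<open>c - (f - P)\<close> with
      \<open>0 \<le> f - P < 1\<close>: the ceiling stays, the P-intercept is kept and the
      Q-intercept rises by 2.\<close>
    have c': "c = \<lceil>P * of_int (n + 1)\<rceil>"
      using large f P_pos unfolding f_def by (simp add: algebra_simps) linarith
    have R: "R \<longleftrightarrow> lit (n + 1) b \<noteq> lit (n + 1) (d + 1 + 1)"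
      using good_VSeg[OF c', of m] by (simp add: R_def b_def d_def algebra_simps)
    have B: "B \<longleftrightarrow> lit m d \<noteq> lit m (d + 1)"
      using good_HSeg_large[OF c_def, of m] large
      by (simp add: B_def b_def d_def f_def algebra_simps)
    have T: "T \<longleftrightarrow> lit (m + 1) (d + 1) \<noteq> lit (m + 1) (d + 1 + 1)"
      using good_HSeg_large[OF c_def, of "m + 1"] large
      by (simp add: T_def b_def d_def f_def algebra_simps)
    have f': "f - P = of_int \<lceil>P * of_int (n + 1)\<rceil> - P * of_int (n + 1)"
      unfolding c'[symmetric] f_def by (simp add: algebra_simps)
    have cap': "cap (n + 1) = 2 * P - 2 * f \<or> cap (n + 1) = 2 * P - 2 * f + 2"
      using cap_of_ceiling[OF f'] by auto
    note between_large_overlap[OF P_pos P_less_1 large f(2)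
        cap_bounds[of n] cap_bounds[of "n + 1"] cap_bounds[of m] cap_bounds[of "m + 1"]
        mass_bounds[of b] mass_bounds[of d] mass_bounds[of "d + 1"] mass_bounds[of "d + 1 + 1"]
        cap_of_ceiling[OF f_def[unfolded c_def]] cap' cap_add_1 mass_add_1 mass_add_1 sum
        mass_nonzero mass_nonzero mass_nonzero mass_nonzero
        mass_neq_cap mass_neq_cap mass_neq_cap mass_neq_cap
        mass_neq_cap mass_neq_cap mass_neq_cap mass_neq_cap]
    then show ?thesis
      unfolding L R B T by blast
  qed
  moreover have "card {s \<in> square_edges n m. good p q s} =
      of_bool B + of_bool T + of_bool L + of_bool R"
    unfolding square_edges_def L_def R_def B_def T_def
    by (rule card_Collect_insert4) simp
  ultimately show ?thesis
    by (cases L; cases R; cases B; cases T; simp)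
qed

end
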